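(* Let $\mathcal A$ be an extremally epireflective subcategory of $\mathcal X$, with $\mathcal A$-reflection morphisms $r_X$, satisfying the following condition: ( * ) whenever $X$ is an object of $\mathcal X$ which is not an object of $\mathcal A$, there exist morphisms $f,g:Z\to X$ such that $f\ne g$ and $r_X\cdot f=r_X\cdot g$, and a morphism $\overline g:X\to Z$ such that $\overline g\cdot g=\overline g\cdot f$ and $g\cdot\overline g\cdot g=g$. Let $\mathcal B$ be a non-cowellpowered reflective subcategory of $\mathcal X$ such that the embedding $\mathcal B\to\mathcal A$ preserves epimorphisms. If $\mathcal A$ and $\mathcal B$ induce the same regular closure operators (up to isomorphism; i.e. $c_{\mathcal A}(m)\cong c_{\mathcal B}(m)$ for all $m\in\mathcal M$), then $\mathcal A$ is non-cowellpowered.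
   Context: Subcategories are always full and isomorphism-closed. $\mathcal X$ is a category with a fixed class $\mathcal M$ of morphisms containing all isomorphisms. $\mathcal X$ is $\mathcal M$-complete: $\mathcal M$ is closed under composition; pullbacks of $\mathcal M$-morphisms exist and belong to $\mathcal M$; multiple pullbacks of (possibly large) families of $\mathcal M$-morphisms with common codomain exist and belong to $\mathcal M$. Consequently every morphism in $\mathcal M$ is a monomorphism, and for each object $X$ the class $\mathcal M/X$ of $\mathcal M$-morphisms with codomain $X$ is a (possibly large) complete preordered class ($m\le n$ iff $m = n\cdot k$ for some $k$); $\cong$ denotes equivalence in this preorder. Moreover $\mathcal X$ has equalizers, cokernel pairs and finite products, and $\mathcal M$ contains all regular monomorphisms of $\mathcal X$. For a subcategory $\mathcal A$, a morphism is an $\mathcal A$-regular monomorphism if it is the equalizer of two morphisms $h,k : Y\to A$ with $A\in\mathcal A$. The regular closure operator induced by $\mathcal A$ is $c_{\mathcal A}(m)=\bigwedge\{r\in\mathcal M \mid r\ge m,\ r \text{ is } \mathcal A\text{-regular}\}$ for $m \in \mathcal M/X$ (meet in $\mathcal M/X$). $\mathcal A$ is extremally epireflective in $\mathcal X$ if it is reflective and all reflection morphisms are extremal epimorphisms. A category is cowellpowered if each object admits only a (small) set of non-equivalent epimorphisms (of that category) with that object as domain; it is non-cowellpowered otherwise. *)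

theory Defs
  imports Main
begin

unbundle cardinal_syntax

section \<open>Categories\<close>

record ('o, 'm) cat =
  Obj :: "'o set"
  Arr :: "'m set"
  Dom :: "'m \<Rightarrow> 'o"
  Cod :: "'m \<Rightarrow> 'o"
  Id :: "'o \<Rightarrow> 'm"
  Comp :: "'m \<Rightarrow> 'm \<Rightarrow> 'm" (infixl \<open>\<cdot>\<index>\<close> 70)

definition hom :: "('o, 'm) cat \<Rightarrow> 'o \<Rightarrow> 'o \<Rightarrow> 'm set" where
  "hom C X Y = {f \<in> Arr C. Dom C f = X \<and> Cod C f = Y}"

locale category =
  fixes C :: "('o, 'm) cat" (structure)
  assumes Dom_Obj: "f \<in> Arr C \<Longrightarrow> Dom C f \<in> Obj C"
    and Cod_Obj: "f \<in> Arr C \<Longrightarrow> Cod C f \<in> Obj C"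
    and Id_hom: "X \<in> Obj C \<Longrightarrow> Id C X \<in> hom C X X"
    and Comp_hom: "\<lbrakk>f \<in> hom C X Y; g \<in> hom C Y Z\<rbrakk> \<Longrightarrow> g \<cdot> f \<in> hom C X Z"
    and Comp_Id_left: "f \<in> hom C X Y \<Longrightarrow> Id C Y \<cdot> f = f"
    and Comp_Id_right: "f \<in> hom C X Y \<Longrightarrow> f \<cdot> Id C X = f"
    and Comp_assoc:
      "\<lbrakk>f \<in> hom C W X; g \<in> hom C X Y; h \<in> hom C Y Z\<rbrakk> \<Longrightarrow> (h \<cdot> g) \<cdot> f = h \<cdot> (g \<cdot> f)"

definition isomorphism :: "('o, 'm) cat \<Rightarrow> 'm \<Rightarrow> bool" where
  "isomorphism C f \<longleftrightarrow> f \<in> Arr C \<and>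
     (\<exists>g \<in> hom C (Cod C f) (Dom C f).
        g \<cdot>\<^bsub>C\<^esub> f = Id C (Dom C f) \<and> f \<cdot>\<^bsub>C\<^esub> g = Id C (Cod C f))"

definition monomorphism :: "('o, 'm) cat \<Rightarrow> 'm \<Rightarrow> bool" where
  "monomorphism C f \<longleftrightarrow> f \<in> Arr C \<and>
     (\<forall>Z. \<forall>x \<in> hom C Z (Dom C f). \<forall>y \<in> hom C Z (Dom C f).
        f \<cdot>\<^bsub>C\<^esub> x = f \<cdot>\<^bsub>C\<^esub> y \<longrightarrow> x = y)"

definition epimorphism :: "('o, 'm) cat \<Rightarrow> 'm \<Rightarrow> bool" where
  "epimorphism C f \<longleftrightarrow> f \<in> Arr C \<and>
     (\<forall>Z. \<forall>x \<in> hom C (Cod C f) Z. \<forall>y \<in> hom C (Cod C f) Z.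
        x \<cdot>\<^bsub>C\<^esub> f = y \<cdot>\<^bsub>C\<^esub> f \<longrightarrow> x = y)"

definition extremal_epimorphism :: "('o, 'm) cat \<Rightarrow> 'm \<Rightarrow> bool" where
  "extremal_epimorphism C e \<longleftrightarrow> epimorphism C e \<and>
     (\<forall>m g. monomorphism C m \<and> g \<in> hom C (Dom C e) (Dom C m) \<and> Cod C m = Cod C e \<and>
        e = m \<cdot>\<^bsub>C\<^esub> g \<longrightarrow> isomorphism C m)"


section \<open>Limits and colimits\<close>

definition is_equalizer :: "('o, 'm) cat \<Rightarrow> 'm \<Rightarrow> 'm \<Rightarrow> 'm \<Rightarrow> bool" where
  "is_equalizer C h k e \<longleftrightarrow>
     h \<in> Arr C \<and> k \<in> hom C (Dom C h) (Cod C h) \<and>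
     e \<in> Arr C \<and> Cod C e = Dom C h \<and> h \<cdot>\<^bsub>C\<^esub> e = k \<cdot>\<^bsub>C\<^esub> e \<and>
     (\<forall>Z. \<forall>z \<in> hom C Z (Dom C h). h \<cdot>\<^bsub>C\<^esub> z = k \<cdot>\<^bsub>C\<^esub> z \<longrightarrow>
        (\<exists>!u. u \<in> hom C Z (Dom C e) \<and> e \<cdot>\<^bsub>C\<^esub> u = z))"

definition regular_mono :: "('o, 'm) cat \<Rightarrow> 'm \<Rightarrow> bool" where
  "regular_mono C e \<longleftrightarrow> (\<exists>h k. is_equalizer C h k e)"

definition has_equalizers :: "('o, 'm) cat \<Rightarrow> bool" where
  "has_equalizers C \<longleftrightarrow>
     (\<forall>X Y. \<forall>h \<in> hom C X Y. \<forall>k \<in> hom C X Y. \<exists>e. is_equalizer C h k e)"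

definition is_cokernel_pair :: "('o, 'm) cat \<Rightarrow> 'm \<Rightarrow> 'm \<Rightarrow> 'm \<Rightarrow> bool" where
  "is_cokernel_pair C f i j \<longleftrightarrow>
     f \<in> Arr C \<and> i \<in> Arr C \<and> Dom C i = Cod C f \<and> j \<in> hom C (Cod C f) (Cod C i) \<and>
     i \<cdot>\<^bsub>C\<^esub> f = j \<cdot>\<^bsub>C\<^esub> f \<and>
     (\<forall>Z. \<forall>x \<in> hom C (Cod C f) Z. \<forall>y \<in> hom C (Cod C f) Z. x \<cdot>\<^bsub>C\<^esub> f = y \<cdot>\<^bsub>C\<^esub> f \<longrightarrow>
        (\<exists>!u. u \<in> hom C (Cod C i) Z \<and> u \<cdot>\<^bsub>C\<^esub> i = x \<and> u \<cdot>\<^bsub>C\<^esub> j = y))"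

definition has_cokernel_pairs :: "('o, 'm) cat \<Rightarrow> bool" where
  "has_cokernel_pairs C \<longleftrightarrow> (\<forall>f \<in> Arr C. \<exists>i j. is_cokernel_pair C f i j)"

definition is_terminal :: "('o, 'm) cat \<Rightarrow> 'o \<Rightarrow> bool" where
  "is_terminal C T \<longleftrightarrow> T \<in> Obj C \<and> (\<forall>X \<in> Obj C. \<exists>!f. f \<in> hom C X T)"

definition is_product :: "('o, 'm) cat \<Rightarrow> 'o \<Rightarrow> 'o \<Rightarrow> 'o \<Rightarrow> 'm \<Rightarrow> 'm \<Rightarrow> bool" where
  "is_product C X Y P p q \<longleftrightarrow>
     p \<in> hom C P X \<and> q \<in> hom C P Y \<and>
     (\<forall>Z. \<forall>x \<in> hom C Z X. \<forall>y \<in> hom C Z Y.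
        \<exists>!u. u \<in> hom C Z P \<and> p \<cdot>\<^bsub>C\<^esub> u = x \<and> q \<cdot>\<^bsub>C\<^esub> u = y)"

definition has_finite_products :: "('o, 'm) cat \<Rightarrow> bool" where
  "has_finite_products C \<longleftrightarrow>
     (\<exists>T. is_terminal C T) \<and>
     (\<forall>X \<in> Obj C. \<forall>Y \<in> Obj C. \<exists>P p q. is_product C X Y P p q)"

text \<open>The first leg \<open>p\<close> is the pullback of \<open>n\<close> along \<open>f\<close>.\<close>

definition is_pullback :: "('o, 'm) cat \<Rightarrow> 'm \<Rightarrow> 'm \<Rightarrow> 'm \<Rightarrow> 'm \<Rightarrow> bool" where
  "is_pullback C f n p q \<longleftrightarrow>
     f \<in> Arr C \<and> n \<in> Arr C \<and> Cod C f = Cod C n \<and>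
     p \<in> Arr C \<and> Cod C p = Dom C f \<and> q \<in> hom C (Dom C p) (Dom C n) \<and>
     f \<cdot>\<^bsub>C\<^esub> p = n \<cdot>\<^bsub>C\<^esub> q \<and>
     (\<forall>Z. \<forall>x \<in> hom C Z (Dom C f). \<forall>y \<in> hom C Z (Dom C n). f \<cdot>\<^bsub>C\<^esub> x = n \<cdot>\<^bsub>C\<^esub> y \<longrightarrow>
        (\<exists>!u. u \<in> hom C Z (Dom C p) \<and> p \<cdot>\<^bsub>C\<^esub> u = x \<and> q \<cdot>\<^bsub>C\<^esub> u = y))"

text \<open>
  The multiple pullback of a family \<open>m\<close> of morphisms with common codomain \<open>X\<close>: its diagonal
  \<open>d\<close> with projections \<open>p i\<close>. The object \<open>X\<close> is a vertex of the diagram, so that the multiple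
  pullback of the empty family is (isomorphic to) the identity of \<open>X\<close>.
\<close>

definition is_multiple_pullback ::
  "('o, 'm) cat \<Rightarrow> 'o \<Rightarrow> 'i set \<Rightarrow> ('i \<Rightarrow> 'm) \<Rightarrow> 'm \<Rightarrow> ('i \<Rightarrow> 'm) \<Rightarrow> bool" where
  "is_multiple_pullback C X I m d p \<longleftrightarrow>
     d \<in> Arr C \<and> Cod C d = X \<and>
     (\<forall>i \<in> I. m i \<in> Arr C \<and> Cod C (m i) = X \<and>
        p i \<in> hom C (Dom C d) (Dom C (m i)) \<and> m i \<cdot>\<^bsub>C\<^esub> p i = d) \<and>
     (\<forall>Z. \<forall>e \<in> hom C Z X. \<forall>q.
        (\<forall>i \<in> I. q i \<in> hom C Z (Dom C (m i)) \<and> m i \<cdot>\<^bsub>C\<^esub> q i = e) \<longrightarrow>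
        (\<exists>!u. u \<in> hom C Z (Dom C d) \<and> d \<cdot>\<^bsub>C\<^esub> u = e \<and> (\<forall>i \<in> I. p i \<cdot>\<^bsub>C\<^esub> u = q i)))"


lemma multiple_pullback_lift:
  assumes "is_multiple_pullback C X I m d p" and "e \<in> hom C Z X"
    and "\<forall>i \<in> I. q i \<in> hom C Z (Dom C (m i)) \<and> m i \<cdot>\<^bsub>C\<^esub> q i = e"
  obtains u where "u \<in> hom C Z (Dom C d)" "d \<cdot>\<^bsub>C\<^esub> u = e" "\<forall>i \<in> I. p i \<cdot>\<^bsub>C\<^esub> u = q i"
proof -
  have "\<forall>Z. \<forall>e \<in> hom C Z X. \<forall>q.
        (\<forall>i \<in> I. q i \<in> hom C Z (Dom C (m i)) \<and> m i \<cdot>\<^bsub>C\<^esub> q i = e) \<longrightarrow>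
        (\<exists>!u. u \<in> hom C Z (Dom C d) \<and> d \<cdot>\<^bsub>C\<^esub> u = e \<and> (\<forall>i \<in> I. p i \<cdot>\<^bsub>C\<^esub> u = q i))"
    using assms(1) unfolding is_multiple_pullback_def by (elim conjE)
  from this[rule_format, OF assms(2), of q] assms(3) that show thesis by metis
qed


section \<open>The ambient category\<close>

definition over :: "('o, 'm) cat \<Rightarrow> 'm set \<Rightarrow> 'o \<Rightarrow> 'm set" where
  "over C M X = {m \<in> M. Cod C m = X}"

text \<open>
  Large families are indexed by arbitrary sets of elements of the type of morphisms. These index
  sets include the class of all morphisms, which is enough to make every morphism in \<open>M\<close> a
  monomorphism (lemma \<open>M_mono\<close> below); a family of monomorphisms has the same multiple pullback
  as its image, so larger index sets would add nothing.
\<close>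

locale M_complete = category C for C :: "('o, 'm) cat" (structure) +
  fixes M :: "'m set"
  assumes M_Arr: "M \<subseteq> Arr C"
    and isomorphism_M: "isomorphism C f \<Longrightarrow> f \<in> M"
    and Comp_M: "\<lbrakk>m \<in> M; n \<in> M; Cod C m = Dom C n\<rbrakk> \<Longrightarrow> n \<cdot> m \<in> M"
    and pullback_ex:
      "\<lbrakk>n \<in> M; f \<in> Arr C; Cod C f = Cod C n\<rbrakk> \<Longrightarrow> \<exists>p q. is_pullback C f n p q"
    and pullback_M: "\<lbrakk>n \<in> M; is_pullback C f n p q\<rbrakk> \<Longrightarrow> p \<in> M"
    and multiple_pullback_ex:
      "\<And>X (I :: 'm set) m. \<lbrakk>X \<in> Obj C; \<forall>i \<in> I. m i \<in> over C M X\<rbrakk>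
         \<Longrightarrow> \<exists>d p. is_multiple_pullback C X I m d p"
    and multiple_pullback_M:
      "\<And>X (I :: 'm set) m d p. \<lbrakk>\<forall>i \<in> I. m i \<in> over C M X; is_multiple_pullback C X I m d p\<rbrakk>
         \<Longrightarrow> d \<in> M"

locale ambient_category = M_complete C M for C :: "('o, 'm) cat" (structure) and M :: "'m set" +
  assumes equalizers: "has_equalizers C"
    and cokernel_pairs: "has_cokernel_pairs C"
    and finite_products: "has_finite_products C"
    and regular_mono_M: "regular_mono C e \<Longrightarrow> e \<in> M"

definition sub_le :: "('o, 'm) cat \<Rightarrow> 'm \<Rightarrow> 'm \<Rightarrow> bool" where
  "sub_le C m n \<longleftrightarrow> Cod C m = Cod C n \<and> (\<exists>k \<in> hom C (Dom C m) (Dom C n). m = n \<cdot>\<^bsub>C\<^esub> k)"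

definition sub_equiv :: "('o, 'm) cat \<Rightarrow> 'm \<Rightarrow> 'm \<Rightarrow> bool" where
  "sub_equiv C m n \<longleftrightarrow> sub_le C m n \<and> sub_le C n m"

definition is_meet :: "('o, 'm) cat \<Rightarrow> 'm set \<Rightarrow> 'o \<Rightarrow> 'm set \<Rightarrow> 'm \<Rightarrow> bool" where
  "is_meet C M X S c \<longleftrightarrow> c \<in> over C M X \<and> (\<forall>s \<in> S. sub_le C c s) \<and>
     (\<forall>n \<in> over C M X. (\<forall>s \<in> S. sub_le C n s) \<longrightarrow> sub_le C n c)"


section \<open>Subcategories\<close>

text \<open>A full, isomorphism-closed subcategory is given by its class of objects.\<close>

definition subcategory :: "('o, 'm) cat \<Rightarrow> 'o set \<Rightarrow> bool" where
  "subcategory C A \<longleftrightarrow> A \<subseteq> Obj C \<and> (\<forall>f. isomorphism C f \<and> Dom C f \<in> A \<longrightarrow> Cod C f \<in> A)"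

definition full_sub :: "('o, 'm) cat \<Rightarrow> 'o set \<Rightarrow> ('o, 'm) cat" where
  "full_sub C A = C\<lparr>Obj := A, Arr := {f \<in> Arr C. Dom C f \<in> A \<and> Cod C f \<in> A}\<rparr>"

definition embedding_preserves_epis :: "('o, 'm) cat \<Rightarrow> 'o set \<Rightarrow> 'o set \<Rightarrow> bool" where
  "embedding_preserves_epis C B A \<longleftrightarrow>
     B \<subseteq> A \<and> (\<forall>f. epimorphism (full_sub C B) f \<longrightarrow> epimorphism (full_sub C A) f)"

definition is_reflection :: "('o, 'm) cat \<Rightarrow> 'o set \<Rightarrow> 'o \<Rightarrow> 'm \<Rightarrow> bool" where
  "is_reflection C A X r \<longleftrightarrow> r \<in> Arr C \<and> Dom C r = X \<and> Cod C r \<in> A \<and>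
     (\<forall>Y \<in> A. \<forall>f \<in> hom C X Y. \<exists>!g. g \<in> hom C (Cod C r) Y \<and> g \<cdot>\<^bsub>C\<^esub> r = f)"

definition reflective :: "('o, 'm) cat \<Rightarrow> 'o set \<Rightarrow> bool" where
  "reflective C A \<longleftrightarrow> subcategory C A \<and> (\<forall>X \<in> Obj C. \<exists>r. is_reflection C A X r)"

definition extremally_epireflective :: "('o, 'm) cat \<Rightarrow> 'o set \<Rightarrow> bool" where
  "extremally_epireflective C A \<longleftrightarrow>
     reflective C A \<and> (\<forall>X \<in> Obj C. \<forall>r. is_reflection C A X r \<longrightarrow> extremal_epimorphism C r)"


section \<open>Regular closure operators\<close>

definition A_regular_mono :: "('o, 'm) cat \<Rightarrow> 'o set \<Rightarrow> 'm \<Rightarrow> bool" where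
  "A_regular_mono C A e \<longleftrightarrow> (\<exists>h k. is_equalizer C h k e \<and> Cod C h \<in> A)"

text \<open>
  Meets in \<open>M/X\<close> are determined only up to \<open>sub_equiv\<close>; the closure is some such meet. It exists
  by lemma \<open>reg_closure_is_meet\<close> below.
\<close>

definition reg_closure :: "('o, 'm) cat \<Rightarrow> 'm set \<Rightarrow> 'o set \<Rightarrow> 'm \<Rightarrow> 'm" where
  "reg_closure C M A m =
     (SOME c. is_meet C M (Cod C m) {r \<in> M. sub_le C m r \<and> A_regular_mono C A r} c)"


section \<open>Cowellpoweredness\<close>

text \<open>
  The distinction between sets and proper classes is rendered by a cardinal \<open>\<kappa>\<close>: a collection is
  small if it has fewer than \<open>\<kappa>\<close> elements. Small and large collections relative to a Grothendieck
  universe are the case of strongly inaccessible \<open>\<kappa>\<close>.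
\<close>

definition small :: "'k rel \<Rightarrow> 'a set \<Rightarrow> bool" where
  "small \<kappa> S \<longleftrightarrow> |S| <o \<kappa>"

definition epi_equiv :: "('o, 'm) cat \<Rightarrow> 'm \<Rightarrow> 'm \<Rightarrow> bool" where
  "epi_equiv C e e' \<longleftrightarrow>
     (\<exists>h \<in> hom C (Cod C e) (Cod C e'). isomorphism C h \<and> h \<cdot>\<^bsub>C\<^esub> e = e')"

definition cowellpowered :: "'k rel \<Rightarrow> ('o, 'm) cat \<Rightarrow> bool" where
  "cowellpowered \<kappa> C \<longleftrightarrow>
     (\<forall>X \<in> Obj C. \<exists>S. small \<kappa> S \<and> S \<subseteq> {e. epimorphism C e \<and> Dom C e = X} \<and>
        (\<forall>e. epimorphism C e \<and> Dom C e = X \<longrightarrow> (\<exists>s \<in> S. epi_equiv C s e)))"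


section \<open>Basic consequences of completeness\<close>

context M_complete
begin

lemma M_mono:
  assumes m: "m \<in> M"
  shows "monomorphism C m"
proof (rule ccontr)
  assume "\<not> monomorphism C m"
  with m M_Arr obtain Z x y where
    x: "x \<in> hom C Z (Dom C m)" and y: "y \<in> hom C Z (Dom C m)"
    and eq: "m \<cdot> x = m \<cdot> y" and ne: "x \<noteq> y"
    unfolding monomorphism_def by blast
  let ?X = "Cod C m"
  have mhom: "m \<in> hom C (Dom C m) ?X" using m M_Arr by (auto simp: hom_def)
  have "?X \<in> Obj C" using m M_Arr Cod_Obj by blast
  then obtain d p where mp: "is_multiple_pullback C ?X (Arr C) (\<lambda>_. m) d p"
    using multiple_pullback_ex[of ?X "Arr C" "\<lambda>_. m"] m by (auto simp: over_def)
  let ?q = "\<lambda>J i. if i \<in> J then x else y"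
  have "\<exists>u. u \<in> Arr C \<and> (\<forall>i \<in> Arr C. p i \<cdot> u = ?q J i)" for J
  proof -
    have "m \<cdot> x \<in> hom C Z ?X" using Comp_hom[OF x mhom] .
    moreover have "\<forall>i \<in> Arr C. ?q J i \<in> hom C Z (Dom C m) \<and> m \<cdot> ?q J i = m \<cdot> x"
      using x y eq by auto
    ultimately obtain u where "u \<in> hom C Z (Dom C d)" "\<forall>i \<in> Arr C. p i \<cdot> u = ?q J i"
      using multiple_pullback_lift[OF mp, of _ Z "?q J"] by blast
    then show ?thesis unfolding hom_def by blast
  qed
  then obtain u where u: "\<And>J. u J \<in> Arr C" and uq: "\<And>J i. i \<in> Arr C \<Longrightarrow> p i \<cdot> u J = ?q J i"
    by metis
  have inj: "J = K" if "J \<subseteq> Arr C" "K \<subseteq> Arr C" "u J = u K" for J K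
  proof -
    have "?q J i = ?q K i" if "i \<in> Arr C" for i
      using uq[OF that, of J] uq[OF that, of K] \<open>u J = u K\<close> by simp
    then have "i \<in> J \<longleftrightarrow> i \<in> K" if "i \<in> Arr C" for i
      using \<open>\<And>i. i \<in> Arr C \<Longrightarrow> ?q J i = ?q K i\<close>[OF that] ne by (auto split: if_splits)
    then show ?thesis using that by blast
  qed
  define D where "D = {u J | J. J \<subseteq> Arr C \<and> u J \<notin> J}"
  have "D \<subseteq> Arr C" using u by (auto simp: D_def)
  have "u D \<notin> D"
  proof
    assume "u D \<in> D"
    then obtain J where J: "J \<subseteq> Arr C" "u D = u J" "u J \<notin> J" unfolding D_def by blast
    then have "J = D" using inj[of D J] \<open>D \<subseteq> Arr C\<close> by simp
    with J \<open>u D \<in> D\<close> show False by simp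
  qed
  moreover from this \<open>D \<subseteq> Arr C\<close> have "u D \<in> D"
    by (subst D_def) blast
  ultimately show False by simp
qed

lemma meet_ex:
  assumes X: "X \<in> Obj C" and S: "S \<subseteq> over C M X"
  shows "\<exists>c. is_meet C M X S c"
proof -
  have fam: "\<forall>i \<in> S. i \<in> over C M X" using S by blast
  obtain d p where mp: "is_multiple_pullback C X S (\<lambda>i. i) d p"
    using multiple_pullback_ex[OF X fam] by blast
  have "d \<in> M" using multiple_pullback_M[OF fam mp] .
  then have d: "d \<in> over C M X" using mp by (simp add: over_def is_multiple_pullback_def)
  have le: "sub_le C d s" if "s \<in> S" for s
    using mp that unfolding is_multiple_pullback_def sub_le_def by metis
  have "sub_le C n d" if n: "n \<in> over C M X" and low: "\<forall>s \<in> S. sub_le C n s" for n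
  proof -
    have nh: "n \<in> hom C (Dom C n) X" using n M_Arr by (auto simp: over_def hom_def)
    have "\<forall>s \<in> S. \<exists>k. k \<in> hom C (Dom C n) (Dom C s) \<and> s \<cdot> k = n"
      using low unfolding sub_le_def by metis
    then obtain q where "\<forall>s \<in> S. q s \<in> hom C (Dom C n) (Dom C s) \<and> s \<cdot> q s = n" by metis
    then obtain u where "u \<in> hom C (Dom C n) (Dom C d)" "d \<cdot> u = n"
      using multiple_pullback_lift[OF mp nh] by blast
    then show ?thesis using n d unfolding sub_le_def over_def by auto
  qed
  with d le show ?thesis unfolding is_meet_def by blast
qed

lemma reg_closure_is_meet:
  assumes "m \<in> M"
  shows "is_meet C M (Cod C m) {r \<in> M. sub_le C m r \<and> A_regular_mono C A r} (reg_closure C M A m)"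
  unfolding reg_closure_def
proof (rule someI_ex, rule meet_ex)
  show "Cod C m \<in> Obj C" using assms M_Arr Cod_Obj by blast
  show "{r \<in> M. sub_le C m r \<and> A_regular_mono C A r} \<subseteq> over C M (Cod C m)"
    by (auto simp: over_def sub_le_def)
qed

end

end

theory Submission
  imports Defs
begin

text \<open>
  The contrapositive holds: if \<open>A\<close> is cowellpowered, so is \<open>B\<close>. An epimorphism of \<open>B\<close> is an
  epimorphism of \<open>A\<close>, since the embedding preserves epimorphisms; so a small set \<open>S\<close> that
  represents the \<open>A\<close>-epimorphisms out of an object of \<open>B\<close> represents in particular its
  \<open>B\<close>-epimorphisms. A representative \<open>s\<close> of a \<open>B\<close>-epimorphism differs from it only by an
  isomorphism, which lies in \<open>B\<close> because \<open>B\<close> is full and closed under isomorphisms; hence \<open>s\<close> is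
  itself a \<open>B\<close>-epimorphism. The members of \<open>S\<close> that are epimorphisms of \<open>B\<close> therefore form the
  small set of representatives required (lemmas \<open>epi_equiv_full_sub\<close> and
  \<open>cowellpowered_full_sub\<close>).
\<close>

lemma full_sub_simps [simp]:
  "Obj (full_sub C A) = A"
  "Arr (full_sub C A) = {f \<in> Arr C. Dom C f \<in> A \<and> Cod C f \<in> A}"
  "Dom (full_sub C A) = Dom C"
  "Cod (full_sub C A) = Cod C"
  "Id (full_sub C A) = Id C"
  "Comp (full_sub C A) = Comp C"
  by (simp_all add: full_sub_def)

lemma hom_full_sub: "f \<in> hom (full_sub C A) X Y \<longleftrightarrow> f \<in> hom C X Y \<and> X \<in> A \<and> Y \<in> A"
  by (auto simp: hom_def)

lemma isomorphism_full_sub: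
  "isomorphism (full_sub C A) h \<longleftrightarrow> isomorphism C h \<and> Dom C h \<in> A \<and> Cod C h \<in> A"
  by (auto simp: isomorphism_def hom_full_sub)

lemma category_full_sub:
  assumes "category C" and "A \<subseteq> Obj C"
  shows "category (full_sub C A)"
proof -
  interpret category C by fact
  show ?thesis
    by (rule category.intro; unfold hom_full_sub full_sub_simps)
      (use assms(2) in \<open>blast intro: Id_hom Comp_hom Comp_Id_left Comp_Id_right Comp_assoc\<close>)+
qed

lemma (in category) epimorphism_of_epi_equiv:
  assumes s: "s \<in> Arr C" and eq: "epi_equiv C s e" and e: "epimorphism C e"
  shows "epimorphism C s"
  unfolding epimorphism_def
proof (intro conjI allI ballI impI s)
  fix Z x y
  assume x: "x \<in> hom C (Cod C s) Z" and y: "y \<in> hom C (Cod C s) Z" and xy: "x \<cdot> s = y \<cdot> s"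
  from eq obtain h where h: "h \<in> hom C (Cod C s) (Cod C e)" "isomorphism C h" "h \<cdot> s = e"
    unfolding epi_equiv_def by blast
  then obtain g where g: "g \<in> hom C (Cod C e) (Cod C s)" "g \<cdot> h = Id C (Cod C s)"
    unfolding isomorphism_def hom_def by auto
  have s': "s \<in> hom C (Dom C s) (Cod C s)" using s by (simp add: hom_def)
  have "g \<cdot> e = s"
    using Comp_assoc[OF s' h(1) g(1)] h(3) g(2) Comp_Id_left[OF s'] by metis
  moreover have "e \<in> hom C (Dom C s) (Cod C e)" using Comp_hom[OF s' h(1)] h(3) by simp
  ultimately have "(x \<cdot> g) \<cdot> e = (y \<cdot> g) \<cdot> e"
    using xy Comp_assoc[OF _ g(1) x] Comp_assoc[OF _ g(1) y] by metis
  then have "x \<cdot> g = y \<cdot> g"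
    using e Comp_hom[OF g(1) x] Comp_hom[OF g(1) y] unfolding epimorphism_def by blast
  then have "x \<cdot> (g \<cdot> h) = y \<cdot> (g \<cdot> h)"
    using Comp_assoc[OF h(1) g(1) x] Comp_assoc[OF h(1) g(1) y] by metis
  then show "x = y"
    unfolding g(2) Comp_Id_right[OF x] Comp_Id_right[OF y] .
qed

text \<open>
  Equivalence of epimorphisms does not leave an isomorphism-closed full subcategory: the inverse of
  the comparison isomorphism starts in \<open>B\<close>, so it also ends in \<open>B\<close>.
\<close>

lemma epi_equiv_full_sub:
  assumes B: "subcategory C B" and eq: "epi_equiv (full_sub C A) s e" and e: "Cod C e \<in> B"
  shows "Cod C s \<in> B" and "epi_equiv (full_sub C B) s e"
proof -
  from eq obtain h where h: "h \<in> hom C (Cod C s) (Cod C e)" "isomorphism C h" "h \<cdot>\<^bsub>C\<^esub> s = e"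
    unfolding epi_equiv_def by (auto simp: hom_full_sub isomorphism_full_sub)
  then obtain g where g: "isomorphism C g" "Dom C g = Cod C e" "Cod C g = Cod C s"
    unfolding isomorphism_def hom_def by auto
  with B e show s: "Cod C s \<in> B" unfolding subcategory_def by metis
  have "isomorphism (full_sub C B) h"
    using h s e by (simp add: isomorphism_full_sub hom_def)
  with h s e show "epi_equiv (full_sub C B) s e"
    unfolding epi_equiv_def by (auto simp: hom_full_sub)
qed

lemma cowellpowered_full_sub:
  assumes C: "category C" and B: "subcategory C B"
    and emb: "embedding_preserves_epis C B A" and A: "cowellpowered \<kappa> (full_sub C A)"
  shows "cowellpowered \<kappa> (full_sub C B)"
  unfolding cowellpowered_def
proof (intro ballI)
  let ?A = "full_sub C A" and ?B = "full_sub C B"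
  interpret B: category ?B
    using category_full_sub[OF C] B unfolding subcategory_def by blast
  fix X assume "X \<in> Obj ?B"
  then have X: "X \<in> B" by simp
  then have "X \<in> Obj ?A" using emb unfolding embedding_preserves_epis_def by auto
  with A obtain S where S: "small \<kappa> S" "S \<subseteq> {e. epimorphism ?A e \<and> Dom ?A e = X}"
    and rep: "\<And>e. epimorphism ?A e \<Longrightarrow> Dom C e = X \<Longrightarrow> \<exists>s \<in> S. epi_equiv ?A s e"
    unfolding cowellpowered_def by auto
  let ?T = "{s \<in> S. epimorphism ?B s}"
  have "|?T| \<le>o |S|" by (rule card_of_mono1) blast
  then have "small \<kappa> ?T" using S(1) unfolding small_def by (rule ordLeq_ordLess_trans)
  moreover have "?T \<subseteq> {e. epimorphism ?B e \<and> Dom ?B e = X}" using S(2) by auto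
  moreover have "\<exists>s \<in> ?T. epi_equiv ?B s e" if e: "epimorphism ?B e" "Dom ?B e = X" for e
  proof -
    from e emb have "epimorphism ?A e" unfolding embedding_preserves_epis_def by blast
    with e rep obtain s where s: "s \<in> S" "epi_equiv ?A s e" by auto
    have "Cod C e \<in> B" using e(1) by (simp add: epimorphism_def)
    note sB = epi_equiv_full_sub[OF B s(2) this]
    have "s \<in> Arr C" "Dom C s = X" using s(1) S(2) by (auto simp: epimorphism_def)
    then have "s \<in> Arr ?B" using sB(1) X by simp
    then have "epimorphism ?B s" using sB(2) e(1) by (rule B.epimorphism_of_epi_equiv)
    with s(1) sB(2) show ?thesis by blast
  qed
  ultimately show "\<exists>S. small \<kappa> S \<and> S \<subseteq> {e. epimorphism ?B e \<and> Dom ?B e = X} \<and>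
      (\<forall>e. epimorphism ?B e \<and> Dom ?B e = X \<longrightarrow> (\<exists>s \<in> S. epi_equiv ?B s e))"
    by (intro exI[of _ ?T]) blast
qed

theorem theorem5p2:
  fixes C :: "('o, 'm) cat" and M :: "'m set" and A B :: "'o set"
    and r :: "'o \<Rightarrow> 'm" and \<kappa> :: "'k rel"
  assumes "ambient_category C M"
    and "Cinfinite \<kappa>"
    and "extremally_epireflective C A"
    and "\<forall>X \<in> Obj C. is_reflection C A X (r X)"
    and "\<forall>X \<in> Obj C - A. \<exists>Z. \<exists>f \<in> hom C Z X. \<exists>g \<in> hom C Z X.
           f \<noteq> g \<and> r X \<cdot>\<^bsub>C\<^esub> f = r X \<cdot>\<^bsub>C\<^esub> g \<and>
           (\<exists>g' \<in> hom C X Z. g' \<cdot>\<^bsub>C\<^esub> g = g' \<cdot>\<^bsub>C\<^esub> f \<and> g \<cdot>\<^bsub>C\<^esub> g' \<cdot>\<^bsub>C\<^esub> g = g)"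
    and "reflective C B"
    and "\<not> cowellpowered \<kappa> (full_sub C B)"
    and "embedding_preserves_epis C B A"
    and "\<forall>m \<in> M. sub_equiv C (reg_closure C M A m) (reg_closure C M B m)"
  shows "\<not> cowellpowered \<kappa> (full_sub C A)"
proof -
  have "category C"
    using assms(1) unfolding ambient_category_def M_complete_def by blast
  moreover have "subcategory C B" using assms(6) unfolding reflective_def by blast
  ultimately show ?thesis using cowellpowered_full_sub assms(7,8) by blast
qed

end
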